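(* Let $n\ge2$, $\ell=\ell(n)$, and let $I\subseteq\{1,2\}^{\ell}$ with $\operatorname{card}(I)=n-2^{\ell}$. Then $\alpha_n(I)$ is a constrained optimal set of $n$-points for $P$, and the $n$th constrained quantization error is \[V_n=V(P;\alpha_n(I))=\frac{1}{18^{\ell}}\cdot\frac18\Big(2^{\ell+1}-n+\frac19(n-2^{\ell})\Big)+A(n,I),\] where the first summand equals the $n$th unconstrained quantization error $V(P;U_n(\alpha_n(I)))$ of $P$.
   Context: $P$ is the Cantor distribution on $\mathbb R$: the unique Borel probability measure with $P=\frac12P\circ T_1^{-1}+\frac12 P\circ T_2^{-1}$, where $T_1(x)=\frac x3$, $T_2(x)=\frac x3+\frac23$. Points $x\in\mathbb R$ are identified with $(x,0)\in\mathbb R^2$. For $j\in\mathbb N$, $S_j=\{(x,y):-\frac1j\le x\le1,\ y=x+\frac1j\}$. For finite $\alpha\subset\mathbb R^2$, $V(P;\alpha)=\int\min_{(p,q)\in\alpha}\big((x-p)^2+q^2\big)\,dP(x)$; the $n$th constrained quantization error is $V_n=\inf\{V(P;\alpha):\alpha\subseteq\bigcup_{j=1}^nS_j,\ 1\le\operatorname{card}(\alpha)\le n\}$, and a constrained optimal set of $n$-points is a set attaining it. Let $\rho(x,(p,q))=(x-p)^2+q^2$. For $\sigma=\sigma_1\cdots\sigma_k\in\{1,2\}^k$, $T_\sigma=T_{\sigma_1}\circ\cdots\circ T_{\sigma_k}$, $a(\sigma)=T_\sigma(\frac12)$; $\sigma1,\sigma2$ are concatenations. $U_n:S_n\to\mathbb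 R$, $U_n(x,x+\frac1n)=2x+\frac1n$, with inverse $U_n^{-1}(u)=\big(\frac12(u-\frac1n),\frac12(u-\frac1n)+\frac1n\big)$. For $n\ge2$, $\ell(n)$ is the unique natural number with $2^{\ell(n)}\le n<2^{\ell(n)+1}$, and for $I\subseteq\{1,2\}^{\ell(n)}$ with $\operatorname{card}(I)=n-2^{\ell(n)}$, \[\alpha_n(I)=\{U_n^{-1}(a(\sigma)):\sigma\in\{1,2\}^{\ell(n)}\setminus I\}\cup\{U_n^{-1}(a(\sigma1)):\sigma\in I\}\cup\{U_n^{-1}(a(\sigma2)):\sigma\in I\}\subseteq S_n,\] \[A(n,I)=\sum_{\sigma\in\{1,2\}^{\ell(n)}\setminus I}\frac{1}{2^{\ell(n)}}\rho\big(a(\sigma),U_n^{-1}(a(\sigma))\big)+\sum_{\sigma\in I}\frac{1}{2^{\ell(n)+1}}\Big(\rho\big(a(\sigma1),U_n^{-1}(a(\sigma1))\big)+\rho\big(a(\sigma2),U_n^{-1}(a(\sigma2))\big)\Big).\] *)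

theory Defs
  imports "HOL-Probability.Probability"
begin

definition T1 :: "real \<Rightarrow> real" where "T1 x = x / 3"
definition T2 :: "real \<Rightarrow> real" where "T2 x = x / 3 + 2 / 3"

definition is_cantor_dist :: "real measure \<Rightarrow> bool" where
  "is_cantor_dist P \<longleftrightarrow> prob_space P \<and> sets P = sets borel \<and>
     (\<forall>A\<in>sets borel. measure P A =
        measure (distr P borel T1) A / 2 + measure (distr P borel T2) A / 2)"

definition rho :: "real \<Rightarrow> real \<times> real \<Rightarrow> real" where
  "rho x pq = (x - fst pq)^2 + (snd pq)^2"

definition Verr :: "real measure \<Rightarrow> (real \<times> real) set \<Rightarrow> real" where
  "Verr P \<alpha> = (\<integral>x. Min ((\<lambda>a. rho x a) ` \<alpha>) \<partial>P)"

definition S :: "nat \<Rightarrow> (real \<times> real) set" where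
  "S j = {(x, y). - 1 / real j \<le> x \<and> x \<le> 1 \<and> y = x + 1 / real j}"

definition constr_admissible :: "nat \<Rightarrow> (real \<times> real) set set" where
  "constr_admissible n = {\<alpha>. \<alpha> \<subseteq> (\<Union>j\<in>{1..n}. S j) \<and> finite \<alpha> \<and> 1 \<le> card \<alpha> \<and> card \<alpha> \<le> n}"

definition Vc :: "real measure \<Rightarrow> nat \<Rightarrow> real" where
  "Vc P n = Inf (Verr P ` constr_admissible n)"

definition constr_optimal :: "real measure \<Rightarrow> nat \<Rightarrow> (real \<times> real) set \<Rightarrow> bool" where
  "constr_optimal P n \<alpha> \<longleftrightarrow> \<alpha> \<in> constr_admissible n \<and> Verr P \<alpha> = Vc P n"

definition Vu :: "real measure \<Rightarrow> nat \<Rightarrow> real" where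
  "Vu P n = Inf {Verr P ((\<lambda>u. (u, 0)) ` \<beta>) | \<beta>. finite \<beta> \<and> 1 \<le> card \<beta> \<and> card \<beta> \<le> n}"

definition words :: "nat \<Rightarrow> nat list set" where
  "words k = {\<sigma>. length \<sigma> = k \<and> set \<sigma> \<subseteq> {1, 2}}"

definition Tmap :: "nat \<Rightarrow> real \<Rightarrow> real" where
  "Tmap i = (if i = 1 then T1 else T2)"

definition Tw :: "nat list \<Rightarrow> real \<Rightarrow> real" where
  "Tw \<sigma> = foldr (\<lambda>i f. Tmap i \<circ> f) \<sigma> id"

definition aw :: "nat list \<Rightarrow> real" where
  "aw \<sigma> = Tw \<sigma> (1 / 2)"

definition U :: "nat \<Rightarrow> real \<times> real \<Rightarrow> real" where
  "U n pq = 2 * fst pq + 1 / real n"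

definition Uinv :: "nat \<Rightarrow> real \<Rightarrow> real \<times> real" where
  "Uinv n u = ((u - 1 / real n) / 2, (u - 1 / real n) / 2 + 1 / real n)"

definition ell :: "nat \<Rightarrow> nat" where
  "ell n = (THE l. 2 ^ l \<le> n \<and> n < 2 ^ (l + 1))"

definition alpha :: "nat \<Rightarrow> nat list set \<Rightarrow> (real \<times> real) set" where
  "alpha n I = (\<lambda>\<sigma>. Uinv n (aw \<sigma>)) ` (words (ell n) - I)
      \<union> (\<lambda>\<sigma>. Uinv n (aw (\<sigma> @ [1]))) ` I
      \<union> (\<lambda>\<sigma>. Uinv n (aw (\<sigma> @ [2]))) ` I"

definition Aterm :: "nat \<Rightarrow> nat list set \<Rightarrow> real" where
  "Aterm n I =
     (\<Sum>\<sigma>\<in>words (ell n) - I. 1 / 2 ^ ell n * rho (aw \<sigma>) (Uinv n (aw \<sigma>)))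
   + (\<Sum>\<sigma>\<in>I. 1 / 2 ^ (ell n + 1) *
        (rho (aw (\<sigma> @ [1])) (Uinv n (aw (\<sigma> @ [1])))
       + rho (aw (\<sigma> @ [2])) (Uinv n (aw (\<sigma> @ [2])))))"

end

theory Submission
  imports Defs
begin

text \<open>
  With \<open>u = p + q\<close> one has \<open>\<rho>(x, (p, q)) = ((x - u)\<^sup>2 + (x + (q - p))\<^sup>2) / 2\<close>, and \<open>q - p = 1 / j\<close>
  on \<open>S\<^sub>j\<close>. As \<open>P\<close> lives on \<open>[0, 1]\<close>, the largest index \<open>j = n\<close> is best, and the constrained
  problem becomes the unconstrained one for the values \<open>u\<close> up to a term that does not depend on the
  points.

  For the unconstrained lower bound, suppose there is a point in each of \<open>(1/6, 1/2)\<close> and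
  \<open>(1/2, 5/6)\<close>. Then the points on either side of \<open>1/2\<close> serve the two halves of the Cantor set
  separately, and self-similarity gives an induction. Otherwise a cell of level two next to the
  central gap is badly served and already contributes \<open>1/288\<close>, which is enough
  except for at most three points; those are treated by the position of the midpoints of
  neighbouring points.
\<close>

section \<open>The distance to a finite set\<close>

text \<open>The integrand of the unconstrained error. \<open>Min\<close> of an empty set is
  unspecified, so nonemptiness is assumed together with finiteness below.\<close>

definition sqd :: "real set \<Rightarrow> real \<Rightarrow> real" where
  "sqd \<beta> x = Min ((\<lambda>u. (x - u)\<^sup>2) ` \<beta>)"

lemma sqd_ge_iff:
  assumes "finite \<beta>" "\<beta> \<noteq> {}"
  shows "z \<le> sqd \<beta> x \<longleftrightarrow> (\<forall>u\<in>\<beta>. z \<le> (x - u)\<^sup>2)"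
  using assms by (simp add: sqd_def)

lemma sqd_le:
  assumes "finite \<beta>" "u \<in> \<beta>"
  shows "sqd \<beta> x \<le> (x - u)\<^sup>2"
  using assms by (simp add: sqd_def)

lemma continuous_sqd [continuous_intros]:
  assumes "finite \<beta>" "\<beta> \<noteq> {}" "continuous_on A f"
  shows "continuous_on A (\<lambda>x. sqd \<beta> (f x))"
  using assms(1,2)
proof (induction rule: finite_ne_induct)
  case (singleton u)
  then show ?case
    using assms(3) by (auto simp: sqd_def intro!: continuous_intros)
next
  case (insert u F)
  have "sqd (insert u F) y = min ((y - u)\<^sup>2) (sqd F y)" for y
    using insert by (simp add: sqd_def)
  then show ?case
    using insert assms(3) by (auto intro!: continuous_intros)
qed

lemma sqd_affine_image:
  assumes "finite \<beta>" "\<beta> \<noteq> {}" "k > 0"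
  shows "sqd \<beta> ((x + t) / k) = sqd ((\<lambda>u. k * u - t) ` \<beta>) x / k\<^sup>2"
proof -
  have "((x + t) / k - u)\<^sup>2 = (x - (k * u - t))\<^sup>2 / k\<^sup>2" for u
    using assms(3) by (simp add: field_simps power2_eq_square)
  then have "sqd \<beta> ((x + t) / k) = Min ((\<lambda>z. z / k\<^sup>2) ` (\<lambda>u. (x - (k * u - t))\<^sup>2) ` \<beta>)"
    by (simp add: sqd_def image_image)
  also have "\<dots> = Min ((\<lambda>u. (x - (k * u - t))\<^sup>2) ` \<beta>) / k\<^sup>2"
    using assms
    by (intro mono_Min_commute[symmetric]) (auto simp: mono_def divide_right_mono)
  finally show ?thesis
    by (simp add: sqd_def image_image)
qed

section \<open>Quantization of a self-similar functional\<close>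

text \<open>Working with functionals instead of measures makes reflection at \<open>1/2\<close> available without
  proving that the Cantor distribution is unique.\<close>

locale cantor_functional =
  fixes L :: "(real \<Rightarrow> real) \<Rightarrow> real"
  assumes add: "\<And>f g. continuous_on UNIV f \<Longrightarrow> continuous_on UNIV g \<Longrightarrow>
      L (\<lambda>x. f x + g x) = L f + L g"
    and scale: "\<And>f c. continuous_on UNIV f \<Longrightarrow> L (\<lambda>x. c * f x) = c * L f"
    and mono: "\<And>f g. continuous_on UNIV f \<Longrightarrow> continuous_on UNIV g \<Longrightarrow>
      (\<And>x. 0 \<le> x \<Longrightarrow> x \<le> 1 \<Longrightarrow> f x \<le> g x) \<Longrightarrow> L f \<le> L g"
    and one: "L (\<lambda>_. 1) = 1"
    and self_similar: "\<And>f. continuous_on UNIV f \<Longrightarrow>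
      L f = (L (\<lambda>x. f (x / 3)) + L (\<lambda>x. f (x / 3 + 2 / 3))) / 2"
begin

section \<open>Moments\<close>

lemma const: "L (\<lambda>_. c) = c"
  using scale[of "\<lambda>_. 1" c] one by simp

text \<open>Self-similarity turns a moment into the solution of a linear equation, here
  \<open>m = (m / 3 + (m / 3 + 2 / 3)) / 2\<close>. The second moment is found in the same
  way.\<close>

lemma first_moment: "L (\<lambda>x. x) = 1 / 2"
proof -
  have "L (\<lambda>x. x / 3) = L (\<lambda>x. x) / 3"
    using scale[of "\<lambda>x. x" "1/3"] by simp
  moreover have "L (\<lambda>x. x / 3 + 2 / 3) = L (\<lambda>x. x / 3) + 2 / 3"
    by (subst add) (auto intro!: continuous_intros simp: const)
  ultimately show ?thesis
    using self_similar[of "\<lambda>x. x"] by simp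
qed

lemma square_expand: "L (\<lambda>x. (p * x + q)\<^sup>2) = p\<^sup>2 * L (\<lambda>x. x\<^sup>2) + p * q + q\<^sup>2"
proof -
  have "(\<lambda>x. (p * x + q)\<^sup>2) = (\<lambda>x. p\<^sup>2 * x\<^sup>2 + ((2 * p * q) * x + q\<^sup>2))"
    by (auto simp: power2_eq_square algebra_simps)
  moreover have "L (\<lambda>x. p\<^sup>2 * x\<^sup>2 + ((2 * p * q) * x + q\<^sup>2))
      = L (\<lambda>x. p\<^sup>2 * x\<^sup>2) + (L (\<lambda>x. (2 * p * q) * x) + L (\<lambda>_. q\<^sup>2))"
    by (subst add, (intro continuous_intros)+)+ simp
  moreover have "L (\<lambda>x. p\<^sup>2 * x\<^sup>2) = p\<^sup>2 * L (\<lambda>x. x\<^sup>2)"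
    by (rule scale) (intro continuous_intros)
  moreover have "L (\<lambda>x. (2 * p * q) * x) = (2 * p * q) * L (\<lambda>x. x)"
    by (rule scale) (intro continuous_intros)
  ultimately show ?thesis
    by (simp add: const first_moment)
qed

lemma second_moment: "L (\<lambda>x. x\<^sup>2) = 3 / 8"
proof -
  have "L (\<lambda>x. x\<^sup>2) = (L (\<lambda>x. ((1/3) * x + 0)\<^sup>2) + L (\<lambda>x. ((1/3) * x + 2 / 3)\<^sup>2)) / 2"
    by (subst self_similar) (auto intro!: continuous_intros)
  then show ?thesis
    unfolding square_expand by (simp add: power2_eq_square)
qed

lemma square: "L (\<lambda>x. (p * x + q)\<^sup>2) = 3 / 8 * p\<^sup>2 + p * q + q\<^sup>2"
  by (simp add: square_expand second_moment)

text \<open>Source of the lower bounds on cells: \<open>p \<noteq> 0\<close> compares with a single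
  virtual point, \<open>p = 0\<close> with a constant distance.\<close>

lemma square_le:
  assumes "continuous_on UNIV f" "\<And>x. 0 \<le> x \<Longrightarrow> x \<le> 1 \<Longrightarrow> (p * x + q)\<^sup>2 \<le> f x"
  shows "3 / 8 * p\<^sup>2 + p * q + q\<^sup>2 \<le> L f"
proof -
  have "continuous_on UNIV (\<lambda>x. (p * x + q)\<^sup>2)"
    by (intro continuous_intros)
  from mono[OF this assms] show ?thesis
    by (simp add: square)
qed

text \<open>Reflection exchanges the two contractions, so it only swaps the two terms of the
  self-similarity axiom.\<close>

lemma reflect: "cantor_functional (\<lambda>f. L (\<lambda>x. f (1 - x)))"
proof (unfold_locales, goal_cases)
  case (5 f)
  have "L (\<lambda>x. f (1 - x)) = (L (\<lambda>x. f (1 - x / 3)) + L (\<lambda>x. f (1 - (x / 3 + 2 / 3)))) / 2"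
    by (rule self_similar) (auto intro!: continuous_intros continuous_on_compose2[OF 5])
  moreover have "1 - x / 3 = (1 - x) / 3 + 2 / 3" "1 - (x / 3 + 2 / 3) = (1 - x) / 3" for x :: real
    by (simp_all add: field_simps)
  ultimately show ?case
    by (simp only: add.commute)
qed (auto intro!: add scale mono one continuous_intros elim!: continuous_on_compose2)

section \<open>Decomposition into cells\<close>

text \<open>The \<open>+ 0\<close> gives the leftmost cell the shape \<open>x / s + t\<close> of the
  cell estimates.\<close>

lemma split2:
  assumes f: "continuous_on UNIV f"
  shows "L f = (L (\<lambda>x. f (x / 3 + 0)) + L (\<lambda>x. f (x / 3 + 2 / 3))) / 2"
  using self_similar[OF f] by simp

lemma split4:
  assumes f: "continuous_on UNIV f"
  shows "L f = (L (\<lambda>x. f (x / 9 + 0)) + L (\<lambda>x. f (x / 9 + 2 / 9))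
             + L (\<lambda>x. f (x / 9 + 2 / 3)) + L (\<lambda>x. f (x / 9 + 8 / 9))) / 4"
proof -
  have "L (\<lambda>x. f (x / 3)) = (L (\<lambda>x. f (x / 3 / 3)) + L (\<lambda>x. f ((x / 3 + 2 / 3) / 3))) / 2"
    by (rule self_similar) (auto intro!: continuous_intros continuous_on_compose2[OF f])
  moreover have "L (\<lambda>x. f (x / 3 + 2 / 3)) =
      (L (\<lambda>x. f (x / 3 / 3 + 2 / 3)) + L (\<lambda>x. f ((x / 3 + 2 / 3) / 3 + 2 / 3))) / 2"
    by (rule self_similar) (auto intro!: continuous_intros continuous_on_compose2[OF f])
  ultimately show ?thesis
    using self_similar[OF f] by (simp add: add_divide_distrib add.assoc)
qed

text \<open>For \<open>middle_server\<close>, where the midpoint of \<open>a\<close> and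
  \<open>b\<close> can fall between the two parts of \<open>[2/9, 1/3]\<close>.\<close>

lemma split_second_quarter:
  assumes f: "continuous_on UNIV f"
  shows "L (\<lambda>x. f (x / 9 + 2 / 9)) = (L (\<lambda>x. f (x / 27 + 2 / 9)) + L (\<lambda>x. f (x / 27 + 8 / 27))) / 2"
proof -
  have "L (\<lambda>x. f (x / 9 + 2 / 9)) = (L (\<lambda>x. f (x / 3 / 9 + 2 / 9)) + L (\<lambda>x. f ((x / 3 + 2 / 3) / 9 + 2 / 9))) / 2"
    by (rule self_similar) (auto intro!: continuous_intros continuous_on_compose2[OF f])
  then show ?thesis
    by (simp add: add_divide_distrib add.assoc)
qed

section \<open>Lower bounds on a single cell\<close>

text \<open>Here \<open>c\<close> is a virtual point, not necessarily in \<open>\<beta>\<close>,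
  that is at least as near to the whole cell as any point. The bound is the variance of the cell
  plus the squared distance of \<open>c\<close> from its centre
  \<open>1 / (2 * s) + t\<close>.\<close>

lemma cell_ge:
  assumes "finite \<beta>" "\<beta> \<noteq> {}" "s > 0"
    and "\<And>y u. t \<le> y \<Longrightarrow> y \<le> t + 1 / s \<Longrightarrow> u \<in> \<beta> \<Longrightarrow> \<bar>y - c\<bar> \<le> \<bar>y - u\<bar>"
  shows "1 / (8 * s\<^sup>2) + (1 / (2 * s) + t - c)\<^sup>2 \<le> L (\<lambda>x. sqd \<beta> (x / s + t))"
proof -
  have "3 / 8 * (1 / s)\<^sup>2 + (1 / s) * (t - c) + (t - c)\<^sup>2 \<le> L (\<lambda>x. sqd \<beta> (x / s + t))"
  proof (rule square_le)
    show "continuous_on UNIV (\<lambda>x. sqd \<beta> (x / s + t))"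
      using assms by (auto intro!: continuous_intros)
    fix x :: real
    assume x: "0 \<le> x" "x \<le> 1"
    then have "(x / s + t - c)\<^sup>2 \<le> (x / s + t - u)\<^sup>2" if "u \<in> \<beta>" for u
      unfolding abs_le_square_iff[symmetric] using assms(3) that
      by (intro assms(4)) (auto simp: divide_right_mono)
    then show "(1 / s * x + (t - c))\<^sup>2 \<le> sqd \<beta> (x / s + t)"
      using assms(1,2) by (simp add: sqd_ge_iff algebra_simps)
  qed
  moreover have "3 / 8 * (1 / s)\<^sup>2 + (1 / s) * (t - c) + (t - c)\<^sup>2
      = 1 / (8 * s\<^sup>2) + (1 / (2 * s) + t - c)\<^sup>2"
    using assms(3) by (simp add: field_simps power2_eq_square)
  ultimately show ?thesis by simp
qed

lemma cell_ge_const: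
  assumes "finite \<beta>" "\<beta> \<noteq> {}" "s > 0" "d \<ge> 0"
    and "\<And>y u. t \<le> y \<Longrightarrow> y \<le> t + 1 / s \<Longrightarrow> u \<in> \<beta> \<Longrightarrow> d \<le> \<bar>y - u\<bar>"
  shows "d\<^sup>2 \<le> L (\<lambda>x. sqd \<beta> (x / s + t))"
proof -
  have "3 / 8 * 0\<^sup>2 + 0 * d + d\<^sup>2 \<le> L (\<lambda>x. sqd \<beta> (x / s + t))"
  proof (rule square_le)
    show "continuous_on UNIV (\<lambda>x. sqd \<beta> (x / s + t))"
      using assms by (auto intro!: continuous_intros)
    fix x :: real
    assume x: "0 \<le> x" "x \<le> 1"
    then have "d\<^sup>2 \<le> (x / s + t - u)\<^sup>2" if "u \<in> \<beta>" for u
      unfolding abs_le_square_iff[symmetric] abs_of_nonneg[OF assms(4)] using assms(3) that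
      by (intro assms(5)) (auto simp: divide_right_mono)
    then show "(0 * x + d)\<^sup>2 \<le> sqd \<beta> (x / s + t)"
      using assms(1,2) by (simp add: sqd_ge_iff)
  qed
  then show ?thesis by simp
qed

lemma cell_nonneg:
  assumes "finite \<beta>" "\<beta> \<noteq> {}" "s > 0"
  shows "0 \<le> L (\<lambda>x. sqd \<beta> (x / s + t))"
  using cell_ge_const[OF assms, of 0] by simp

section \<open>Separation of the two halves and reflection\<close>

text \<open>The factor \<open>1 / 18\<close> combines the weight \<open>1 / 2\<close> of each half
  with the factor \<open>1 / 9\<close> from magnifying it by three.\<close>

lemma sqd_separated:
  assumes fin: "finite \<beta>" "finite \<gamma>" and ne: "\<beta> \<noteq> {}" "\<gamma> \<noteq> {}"
    and left: "\<And>x u. 0 \<le> x \<Longrightarrow> x \<le> 1 / 3 \<Longrightarrow> u \<in> \<gamma> \<Longrightarrow> \<exists>w\<in>\<beta>. \<bar>x - w\<bar> \<le> \<bar>x - u\<bar>"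
    and right: "\<And>x u. 2 / 3 \<le> x \<Longrightarrow> x \<le> 1 \<Longrightarrow> u \<in> \<beta> \<Longrightarrow> \<exists>w\<in>\<gamma>. \<bar>x - w\<bar> \<le> \<bar>x - u\<bar>"
  shows "(L (sqd ((\<lambda>u. 3 * u) ` \<beta>)) + L (sqd ((\<lambda>u. 3 * u - 2) ` \<gamma>))) / 18 \<le> L (sqd (\<beta> \<union> \<gamma>))"
proof -
  have sq: "sqd A x \<le> (x - u)\<^sup>2" if "\<exists>w\<in>A. \<bar>x - w\<bar> \<le> \<bar>x - u\<bar>" "finite A" for A x u
  proof -
    from that obtain w where w: "w \<in> A" "\<bar>x - w\<bar> \<le> \<bar>x - u\<bar>" by blast
    have "sqd A x \<le> (x - w)\<^sup>2"
      by (rule sqd_le[OF that(2) w(1)])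
    also have "\<dots> \<le> (x - u)\<^sup>2"
      using w(2) by (simp only: abs_le_square_iff)
    finally show ?thesis .
  qed
  have l: "sqd \<beta> x \<le> sqd (\<beta> \<union> \<gamma>) x" if "0 \<le> x" "x \<le> 1 / 3" for x
  proof -
    have "sqd \<beta> x \<le> (x - u)\<^sup>2" if "u \<in> \<beta> \<union> \<gamma>" for u
      using that left[OF \<open>0 \<le> x\<close> \<open>x \<le> 1 / 3\<close>] fin by (auto intro: sq sqd_le)
    then show ?thesis
      using fin ne by (simp add: sqd_ge_iff)
  qed
  have r: "sqd \<gamma> x \<le> sqd (\<beta> \<union> \<gamma>) x" if "2 / 3 \<le> x" "x \<le> 1" for x
  proof -
    have "sqd \<gamma> x \<le> (x - u)\<^sup>2" if "u \<in> \<beta> \<union> \<gamma>" for u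
      using that right[OF \<open>2 / 3 \<le> x\<close> \<open>x \<le> 1\<close>] fin by (auto intro: sq sqd_le)
    then show ?thesis
      using fin ne by (simp add: sqd_ge_iff)
  qed
  have "L (\<lambda>x. sqd \<beta> (x / 3)) \<le> L (\<lambda>x. sqd (\<beta> \<union> \<gamma>) (x / 3))"
    using fin ne by (intro mono l continuous_intros) auto
  moreover have "L (\<lambda>x. sqd \<gamma> (x / 3 + 2 / 3)) \<le> L (\<lambda>x. sqd (\<beta> \<union> \<gamma>) (x / 3 + 2 / 3))"
    using fin ne by (intro mono r continuous_intros) auto
  moreover have "L (\<lambda>x. sqd \<beta> (x / 3)) = L (sqd ((\<lambda>u. 3 * u) ` \<beta>)) / 9"
  proof -
    have "sqd \<beta> (x / 3) = (1 / 9) * sqd ((\<lambda>u. 3 * u) ` \<beta>) x" for x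
      using sqd_affine_image[OF fin(1) ne(1), of 3 x 0] by simp
    then have "L (\<lambda>x. sqd \<beta> (x / 3)) = L (\<lambda>x. (1 / 9) * sqd ((\<lambda>u. 3 * u) ` \<beta>) x)"
      by presburger
    also have "\<dots> = (1 / 9) * L (sqd ((\<lambda>u. 3 * u) ` \<beta>))"
      using fin ne by (intro scale continuous_intros) auto
    finally show ?thesis by simp
  qed
  moreover have "L (\<lambda>x. sqd \<gamma> (x / 3 + 2 / 3)) = L (sqd ((\<lambda>u. 3 * u - 2) ` \<gamma>)) / 9"
  proof -
    have "sqd \<gamma> (x / 3 + 2 / 3) = (1 / 9) * sqd ((\<lambda>u. 3 * u - 2) ` \<gamma>) x" for x
      using sqd_affine_image[OF fin(2) ne(2), of 3 x 2] by (simp add: add_divide_distrib)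
    then have "L (\<lambda>x. sqd \<gamma> (x / 3 + 2 / 3)) = L (\<lambda>x. (1 / 9) * sqd ((\<lambda>u. 3 * u - 2) ` \<gamma>) x)"
      by presburger
    also have "\<dots> = (1 / 9) * L (sqd ((\<lambda>u. 3 * u - 2) ` \<gamma>))"
      using fin ne by (intro scale continuous_intros) auto
    finally show ?thesis by simp
  qed
  moreover have "L (sqd (\<beta> \<union> \<gamma>)) =
      (L (\<lambda>x. sqd (\<beta> \<union> \<gamma>) (x / 3)) + L (\<lambda>x. sqd (\<beta> \<union> \<gamma>) (x / 3 + 2 / 3))) / 2"
    using fin ne by (intro self_similar continuous_intros) auto
  ultimately show ?thesis
    by simp
qed

lemma reflect_sqd:
  "L (\<lambda>x. sqd ((\<lambda>u. 1 - u) ` \<beta>) (1 - x)) = L (sqd \<beta>)"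
proof -
  have "(1 - x - (1 - u))\<^sup>2 = (x - u)\<^sup>2" for x u :: real
    by (simp add: power2_eq_square algebra_simps)
  then have "sqd ((\<lambda>u. 1 - u) ` \<beta>) (1 - x) = sqd \<beta> x" for x
    by (simp only: sqd_def image_image)
  then show ?thesis
    by simp
qed

text \<open>Mirroring both functional and points preserves the error. The premise ranges over all
  functionals because it is applied to the mirrored one.\<close>

lemma reflect_bound:
  assumes "\<And>L. cantor_functional L \<Longrightarrow> z \<le> L (sqd ((\<lambda>u. 1 - u) ` \<beta>))"
  shows "z \<le> L (sqd \<beta>)"
  using assms[OF reflect] by (simp add: reflect_sqd)

section \<open>One, two and three points\<close>

lemma one_point: "1 / 8 \<le> L (sqd {b})"
proof -
  have "1 / 8 \<le> 1 / (8 * 1\<^sup>2) + (1 / (2 * 1) + 0 - b)\<^sup>2"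
    by simp
  also have "\<dots> \<le> L (\<lambda>x. sqd {b} (x / 1 + 0))"
    by (rule cell_ge) auto
  finally show ?thesis by simp
qed

text \<open>All midpoints with \<open>c\<close> are at most \<open>1 / 3\<close>, so
  \<open>c\<close> alone serves the right half. If \<open>c\<close> is small, that half is
  expensive; if \<open>c\<close> is large, the other points are pushed below 0 and
  \<open>[2/9, 1/3]\<close> is expensive.\<close>

lemma sole_right_server:
  assumes fin: "finite \<beta>" and c: "c \<in> \<beta>"
    and others: "\<And>u. u \<in> \<beta> \<Longrightarrow> u \<noteq> c \<Longrightarrow> u \<le> c \<and> u + c \<le> 2 / 3"
  shows "1 / 72 \<le> L (sqd \<beta>)"
proof -
  have ne: "\<beta> \<noteq> {}" using c by auto
  have cont: "continuous_on UNIV (sqd \<beta>)"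
    using fin ne by (auto intro!: continuous_intros)
  show ?thesis
  proof (cases "c < 7 / 10")
    case True
    have "1 / (8 * 3\<^sup>2) + (1 / (2 * 3) + 2 / 3 - c)\<^sup>2 \<le> L (\<lambda>x. sqd \<beta> (x / 3 + 2 / 3))"
    proof (rule cell_ge[OF fin ne])
      fix y u :: real
      assume "2 / 3 \<le> y" "u \<in> \<beta>"
      with others[of u] show "\<bar>y - c\<bar> \<le> \<bar>y - u\<bar>"
        by (cases "u = c") auto
    qed simp
    \<comment> \<open>\<open>2 / 15\<close> is the distance from \<open>7 / 10\<close> to the centre
      \<open>5 / 6\<close> of the right half.\<close>
    moreover have "(2 / 15)\<^sup>2 \<le> (1 / (2 * 3) + 2 / 3 - c)\<^sup>2"
      using True by (intro power_mono) auto
    moreover have "0 \<le> L (\<lambda>x. sqd \<beta> (x / 3 + 0))"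
      by (rule cell_nonneg[OF fin ne]) simp
    ultimately show ?thesis
      unfolding split2[OF cont] by (simp add: power2_eq_square)
  next
    case False
    \<comment> \<open>Now the other points are at most \<open>2 / 3 - 7 / 10 = - 1 / 30\<close>,
      hence at least \<open>23 / 90\<close> from the cell, and \<open>c\<close> is at least
      \<open>11 / 30\<close> from it.\<close>
    have "(23 / 90)\<^sup>2 \<le> L (\<lambda>x. sqd \<beta> (x / 9 + 2 / 9))"
    proof (rule cell_ge_const[OF fin ne])
      fix y u :: real
      assume "2 / 9 \<le> y" "y \<le> 2 / 9 + 1 / 9" "u \<in> \<beta>"
      with others[of u] False show "23 / 90 \<le> \<bar>y - u\<bar>"
        by (cases "u = c") auto
    qed simp_all
    moreover have "0 \<le> L (\<lambda>x. sqd \<beta> (x / 9 + 0))" "0 \<le> L (\<lambda>x. sqd \<beta> (x / 9 + 2 / 3))"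
      "0 \<le> L (\<lambda>x. sqd \<beta> (x / 9 + 8 / 9))"
      by (rule cell_nonneg[OF fin ne]; simp)+
    ultimately show ?thesis
      unfolding split4[OF cont] by (simp add: power2_eq_square)
  qed
qed

text \<open>As \<open>1 / 2\<close> and \<open>5 / 6\<close> are equidistant from
  \<open>2 / 3\<close>, the virtual point \<open>5 / 6\<close> is at least as near to
  \<open>[2/3, 7/9]\<close> as any point. This cell costs at least \<open>1 / 72\<close> and has
  weight \<open>1 / 4\<close>.\<close>

lemma gap_right:
  assumes fin: "finite \<beta>" and ne: "\<beta> \<noteq> {}"
    and gap: "\<And>u. u \<in> \<beta> \<Longrightarrow> u \<le> 1 / 2 \<or> 5 / 6 \<le> u"
  shows "1 / 288 \<le> L (sqd \<beta>)"
proof -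
  have cont: "continuous_on UNIV (sqd \<beta>)"
    using fin ne by (auto intro!: continuous_intros)
  have "1 / (8 * 9\<^sup>2) + (1 / (2 * 9) + 2 / 3 - 5 / 6)\<^sup>2 \<le> L (\<lambda>x. sqd \<beta> (x / 9 + 2 / 3))"
  proof (rule cell_ge[OF fin ne])
    fix y u :: real
    assume "2 / 3 \<le> y" "y \<le> 2 / 3 + 1 / 9" "u \<in> \<beta>"
    with gap[of u] show "\<bar>y - 5 / 6\<bar> \<le> \<bar>y - u\<bar>"
      by auto
  qed simp
  moreover have "0 \<le> L (\<lambda>x. sqd \<beta> (x / 9 + 0))" "0 \<le> L (\<lambda>x. sqd \<beta> (x / 9 + 2 / 9))"
    "0 \<le> L (\<lambda>x. sqd \<beta> (x / 9 + 8 / 9))"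
    by (rule cell_nonneg[OF fin ne]; simp)+
  ultimately show ?thesis
    unfolding split4[OF cont] by (simp add: power2_eq_square)
qed

text \<open>The cases place the midpoint of \<open>b\<close> and \<open>c\<close> left of the
  central gap, in it, or right of it. In the gap each point serves one half:
  \<open>(1 / 8 + 1 / 8) / 18 = 1 / 72\<close>.\<close>

lemma two_points:
  assumes "b \<le> c"
  shows "1 / 72 \<le> L (sqd {b, c})"
proof -
  consider "b + c < 2 / 3" | "2 / 3 \<le> b + c" "b + c \<le> 4 / 3" | "4 / 3 < b + c"
    by linarith
  then show ?thesis
  proof cases
    case 1
    with assms show ?thesis
      by (intro sole_right_server[of _ c]) auto
  next
    case 2
    have "(L (sqd ((\<lambda>u. 3 * u) ` {b})) + L (sqd ((\<lambda>u. 3 * u - 2) ` {c}))) / 18 \<le> L (sqd ({b} \<union> {c}))"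
      using assms 2 by (intro sqd_separated) auto
    moreover have "{b} \<union> {c} = {b, c}"
      by auto
    ultimately show ?thesis
      using one_point[of "3 * b"] one_point[of "3 * c - 2"] by simp
  next
    case 3
    show ?thesis
      using assms 3 by (intro reflect_bound cantor_functional.sole_right_server[of _ _ "1 - b"]) auto
  qed
qed

text \<open>In \<open>middle_server\<close> the point \<open>b\<close> serves part of both halves. If \<open>b \<le> 7/16\<close>, the cell
  \<open>[2/3, 7/9]\<close> alone costs enough. Otherwise it costs at least \<open>1/288\<close>, and \<open>b\<close> is too far from
  the left half to help \<open>a\<close> there; the rest is found in \<open>[0, 1/9]\<close>, \<open>[2/9, 7/27]\<close> and
  \<open>[8/27, 1/3]\<close>, depending on \<open>a\<close>. The value \<open>19/162\<close> is the best \<open>a\<close> for the first two.\<close>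

lemma middle_server:
  assumes ab: "a \<le> b" and b: "b \<le> 1 / 2" and bc: "4 / 3 \<le> b + c"
  shows "5 / 648 \<le> L (sqd {a, b, c})"
proof -
  let ?\<beta> = "{a, b, c}"
  have fin: "finite ?\<beta>" and ne: "?\<beta> \<noteq> {}" by auto
  have cont: "continuous_on UNIV (sqd ?\<beta>)"
    by (auto intro!: continuous_intros)
  have nn: "0 \<le> L (\<lambda>x. sqd ?\<beta> (x / 9 + 0))" "0 \<le> L (\<lambda>x. sqd ?\<beta> (x / 9 + 2 / 9))"
    "0 \<le> L (\<lambda>x. sqd ?\<beta> (x / 9 + 8 / 9))"
    by (rule cell_nonneg[OF fin ne]; simp)+
  show ?thesis
  proof (cases "b \<le> 7 / 16")
    case True
    \<comment> \<open>\<open>c\<close> is at least \<open>43 / 48 = 4 / 3 - 7 / 16\<close>, whose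
      midpoint with \<open>7 / 16\<close> is \<open>2 / 3\<close>; so \<open>a\<close> and
      \<open>b\<close> are no nearer to the cell than \<open>43 / 48\<close>.\<close>
    have "1 / (8 * 9\<^sup>2) + (1 / (2 * 9) + 2 / 3 - 43 / 48)\<^sup>2 \<le> L (\<lambda>x. sqd ?\<beta> (x / 9 + 2 / 3))"
      using assms True by (intro cell_ge[OF fin ne]) auto
    with nn show ?thesis
      unfolding split4[OF cont] by (simp add: power2_eq_square)
  next
    case False
    have J21: "1 / (8 * 9\<^sup>2) + (1 / (2 * 9) + 2 / 3 - 5 / 6)\<^sup>2 \<le> L (\<lambda>x. sqd ?\<beta> (x / 9 + 2 / 3))"
      using assms by (intro cell_ge[OF fin ne]) auto
    consider "a \<le> 1 / 12" | "1 / 12 < a" "a < 1 / 5" | "1 / 5 \<le> a"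
      by linarith
    then show ?thesis
    proof cases
      case 1
      \<comment> \<open>\<open>5 / 36 = 2 / 9 - 1 / 12\<close> bounds the distance to
        \<open>a\<close>; \<open>b > 7 / 16\<close> is farther away.\<close>
      have "(5 / 36)\<^sup>2 \<le> L (\<lambda>x. sqd ?\<beta> (x / 27 + 2 / 9))"
        using assms False 1 by (intro cell_ge_const[OF fin ne]) auto
      moreover have "1 / (8 * 27\<^sup>2) + (1 / (2 * 27) + 8 / 27 - 7 / 16)\<^sup>2 \<le> L (\<lambda>x. sqd ?\<beta> (x / 27 + 8 / 27))"
        using assms False 1 by (intro cell_ge[OF fin ne]) auto
      moreover have "5 / 648 \<le> (((5 / 36)\<^sup>2 + (1 / (8 * 27\<^sup>2) + (1 / (2 * 27) + 8 / 27 - 7 / 16)\<^sup>2)) / 2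
          + (1 / (8 * 9\<^sup>2) + (1 / (2 * 9) + 2 / 3 - 5 / 6)\<^sup>2)) / (4 :: real)"
        by (simp add: power2_eq_square)
      ultimately show ?thesis
        using J21 nn unfolding split4[OF cont] split_second_quarter[OF cont]
        by argo
    next
      case 2
      have "1 / (8 * 9\<^sup>2) + (1 / (2 * 9) + 0 - a)\<^sup>2 \<le> L (\<lambda>x. sqd ?\<beta> (x / 9 + 0))"
        using assms False 2 by (intro cell_ge[OF fin ne]) auto
      \<comment> \<open>The midpoint of \<open>a\<close> and \<open>b\<close> exceeds
        \<open>25 / 96 > 7 / 27\<close>, so this cell belongs to \<open>a\<close>.\<close>
      moreover have "1 / (8 * 27\<^sup>2) + (1 / (2 * 27) + 2 / 9 - a)\<^sup>2 \<le> L (\<lambda>x. sqd ?\<beta> (x / 27 + 2 / 9))"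
        using assms False 2 by (intro cell_ge[OF fin ne]) auto
      moreover have "(13 / 135)\<^sup>2 \<le> L (\<lambda>x. sqd ?\<beta> (x / 27 + 8 / 27))"
        using assms False 2 by (intro cell_ge_const[OF fin ne]) auto
      moreover have "5 / 648 \<le> (1 / (8 * 9\<^sup>2) + (1 / (2 * 9) + 0 - a)\<^sup>2
          + (1 / (8 * 27\<^sup>2) + (1 / (2 * 27) + 2 / 9 - a)\<^sup>2 + (13 / 135)\<^sup>2) / 2
          + (1 / (8 * 9\<^sup>2) + (1 / (2 * 9) + 2 / 3 - 5 / 6)\<^sup>2)) / 4"
        using zero_le_square[of "a - 19 / 162"]
        by (simp add: power2_eq_square field_simps)
      ultimately show ?thesis
        using J21 nn unfolding split4[OF cont] split_second_quarter[OF cont]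
        by argo
    next
      case 3
      have "1 / (8 * 9\<^sup>2) + (1 / (2 * 9) + 0 - 1 / 5)\<^sup>2 \<le> L (\<lambda>x. sqd ?\<beta> (x / 9 + 0))"
        using assms False 3 by (intro cell_ge[OF fin ne]) auto
      with J21 nn show ?thesis
        unfolding split4[OF cont] by (simp add: power2_eq_square)
    qed
  qed
qed

text \<open>If a midpoint of neighbours lies in the central gap, one half gets one point and the
  other gets two: \<open>(1 / 8 + 1 / 72) / 18 = 5 / 648\<close>. If both midpoints lie on the same
  side of the gap, one point serves a whole half; if on opposite sides, \<open>middle_server\<close>
  applies.\<close>

lemma three_points:
  assumes "a \<le> b" "b \<le> c"
  shows "5 / 648 \<le> L (sqd {a, b, c})"
proof -
  consider "b + c < 2 / 3" | "4 / 3 < a + b" | "2 / 3 \<le> a + b" "a + b \<le> 4 / 3"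
    | "2 / 3 \<le> b + c" "b + c \<le> 4 / 3" | "a + b < 2 / 3" "4 / 3 < b + c"
    using assms by linarith
  then show ?thesis
  proof cases
    case 1
    with assms have "1 / 72 \<le> L (sqd {a, b, c})"
      by (intro sole_right_server[of _ c]) auto
    then show ?thesis by simp
  next
    case 2
    with assms have "1 / 72 \<le> L (sqd {a, b, c})"
      by (intro reflect_bound cantor_functional.sole_right_server[of _ _ "1 - a"]) auto
    then show ?thesis by simp
  next
    case 3
    have "(L (sqd ((\<lambda>u. 3 * u) ` {a})) + L (sqd ((\<lambda>u. 3 * u - 2) ` {b, c}))) / 18 \<le> L (sqd ({a} \<union> {b, c}))"
      using assms 3 by (intro sqd_separated) auto
    moreover have "{a} \<union> {b, c} = {a, b, c}" by auto
    ultimately show ?thesis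
      using one_point[of "3 * a"] two_points[of "3 * b - 2" "3 * c - 2"] assms by simp
  next
    case 4
    have "(L (sqd ((\<lambda>u. 3 * u) ` {a, b})) + L (sqd ((\<lambda>u. 3 * u - 2) ` {c}))) / 18 \<le> L (sqd ({a, b} \<union> {c}))"
      using assms 4 by (intro sqd_separated) auto
    moreover have "{a, b} \<union> {c} = {a, b, c}" by auto
    ultimately show ?thesis
      using two_points[of "3 * a" "3 * b"] one_point[of "3 * c - 2"] assms by simp
  next
    case 5
    show ?thesis
    proof (cases "b \<le> 1 / 2")
      case True
      with 5 assms show ?thesis
        by (intro middle_server) auto
    next
      case False
      have "(\<lambda>u. 1 - u) ` {a, b, c} = {1 - c, 1 - b, 1 - a}"
        by auto
      with cantor_functional.middle_server[of _ "1 - c" "1 - b" "1 - a"] False 5 assms show ?thesis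
        by (intro reflect_bound) simp
    qed
  qed
qed

text \<open>These are the lines at levels 0 and 1 of the induction below. The first passes through
  the values \<open>1 / 8\<close> and \<open>1 / 72\<close> at cardinalities 1 and 2, the second
  through \<open>1 / 72\<close> and \<open>5 / 648\<close> at 2 and 3.\<close>

lemma at_most_three_points:
  assumes "finite \<beta>" "\<beta> \<noteq> {}" "card \<beta> \<le> 3"
  shows "(17 - 8 * real (card \<beta>)) / 72 \<le> L (sqd \<beta>)"
    and "(34 - 8 * real (card \<beta>)) / 1296 \<le> L (sqd \<beta>)"
proof -
  have "card \<beta> \<noteq> 0" using assms by simp
  then consider "card \<beta> = 1" | "card \<beta> = 2" | "card \<beta> = 3"
    using assms(3) by linarith
  then have "(17 - 8 * real (card \<beta>)) / 72 \<le> L (sqd \<beta>) \<and> (34 - 8 * real (card \<beta>)) / 1296 \<le> L (sqd \<beta>)"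
  proof cases
    case 1
    then obtain b where "\<beta> = {b}" by (auto simp: card_1_singleton_iff)
    with one_point[of b] show ?thesis by simp
  next
    case 2
    then obtain b c where bc: "\<beta> = {b, c}" "b \<noteq> c" by (auto simp: card_2_iff)
    have "1 / 72 \<le> L (sqd \<beta>)"
      using two_points[of b c] two_points[of c b] bc by (cases "b \<le> c") (auto simp: insert_commute)
    with 2 show ?thesis by simp
  next
    case 3
    have "sorted_list_of_set \<beta> ! 0 \<le> sorted_list_of_set \<beta> ! 1"
      "sorted_list_of_set \<beta> ! 1 \<le> sorted_list_of_set \<beta> ! 2"
      using 3 by (auto intro!: sorted_nth_mono)
    moreover have "\<beta> = {sorted_list_of_set \<beta> ! 0, sorted_list_of_set \<beta> ! 1, sorted_list_of_set \<beta> ! 2}"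
    proof -
      have "\<beta> = (\<lambda>i. sorted_list_of_set \<beta> ! i) ` {..<3}"
        using 3 assms(1) by (metis length_sorted_list_of_set lessThan_atLeast0 list.set_map map_nth set_sorted_list_of_set set_upt)
      moreover have "{..<3} = {0, 1, 2::nat}" by auto
      ultimately show ?thesis by simp
    qed
    ultimately have "5 / 648 \<le> L (sqd \<beta>)"
      using three_points by metis
    with 3 show ?thesis by simp
  qed
  then show "(17 - 8 * real (card \<beta>)) / 72 \<le> L (sqd \<beta>)"
    "(34 - 8 * real (card \<beta>)) / 1296 \<le> L (sqd \<beta>)" by auto
qed

section \<open>The lower bound for all cardinalities\<close>

text \<open>\<open>1 / 6\<close> and \<open>5 / 6\<close> are the mirror images of
  \<open>1 / 2\<close> in \<open>1 / 3\<close> and \<open>2 / 3\<close>. Hence a point in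
  \<open>(1/6, 1/2)\<close> is nearer to all of \<open>[0, 1/3]\<close> than any point right of
  \<open>1 / 2\<close>, and symmetrically.\<close>

lemma gap_or_separated:
  assumes fin: "finite \<beta>" and ne: "\<beta> \<noteq> {}"
  obtains "1 / 288 \<le> L (sqd \<beta>)"
  | \<beta>1 \<beta>2 where "finite \<beta>1" "finite \<beta>2" "\<beta>1 \<noteq> {}" "\<beta>2 \<noteq> {}" "card \<beta>1 + card \<beta>2 = card \<beta>"
      "(L (sqd \<beta>1) + L (sqd \<beta>2)) / 18 \<le> L (sqd \<beta>)"
proof (cases "(\<forall>u\<in>\<beta>. u \<le> 1 / 2 \<or> 5 / 6 \<le> u) \<or> (\<forall>u\<in>\<beta>. u \<le> 1 / 6 \<or> 1 / 2 \<le> u)")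
  case True
  then have "1 / 288 \<le> L (sqd \<beta>)"
  proof
    assume "\<forall>u\<in>\<beta>. u \<le> 1 / 2 \<or> 5 / 6 \<le> u"
    then show ?thesis using fin ne by (intro gap_right) auto
  next
    assume *: "\<forall>u\<in>\<beta>. u \<le> 1 / 6 \<or> 1 / 2 \<le> u"
    then show ?thesis
      using fin ne by (intro reflect_bound cantor_functional.gap_right) auto
  qed
  then show ?thesis by (rule that(1))
next
  case False
  then obtain p q where p: "p \<in> \<beta>" "1 / 2 < p" "p < 5 / 6" and q: "q \<in> \<beta>" "1 / 6 < q" "q < 1 / 2"
    by (auto simp: not_le)
  define B C where "B = {u\<in>\<beta>. u \<le> 1 / 2}" and "C = {u\<in>\<beta>. 1 / 2 < u}"
  have BC: "\<beta> = B \<union> C" "B \<inter> C = {}" "finite B" "finite C" "q \<in> B" "p \<in> C"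
    using fin p q by (auto simp: B_def C_def)
  have "(L (sqd ((\<lambda>u. 3 * u) ` B)) + L (sqd ((\<lambda>u. 3 * u - 2) ` C))) / 18 \<le> L (sqd (B \<union> C))"
  proof (rule sqd_separated)
    fix x u :: real
    assume "0 \<le> x" "x \<le> 1 / 3" "u \<in> C"
    then show "\<exists>w\<in>B. \<bar>x - w\<bar> \<le> \<bar>x - u\<bar>"
      using q BC(5) by (intro bexI[of _ q]) (auto simp: C_def)
  next
    fix x u :: real
    assume "2 / 3 \<le> x" "x \<le> 1" "u \<in> B"
    then show "\<exists>w\<in>C. \<bar>x - w\<bar> \<le> \<bar>x - u\<bar>"
      using p BC(6) by (intro bexI[of _ p]) (auto simp: B_def)
  qed (use BC in auto)
  moreover have "card ((\<lambda>u. 3 * u) ` B) + card ((\<lambda>u. 3 * u - 2) ` C) = card \<beta>"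
    using BC by (simp add: card_image inj_on_def card_Un_disjoint)
  ultimately show ?thesis
    using BC by (intro that(2)[of "(\<lambda>u. 3 * u) ` B" "(\<lambda>u. 3 * u - 2) ` C"]) auto
qed

text \<open>As functions of the cardinality, these bounds are the supporting lines of the convex
  piecewise linear error: the line at level \<open>l\<close> interpolates the errors at \<open>2 ^ l\<close> and
  \<open>2 ^ (l + 1)\<close>. Separation turns two lines at level \<open>l\<close> into the one at level \<open>l + 1\<close>, for
  every way of distributing the points, so no convexity argument is needed.\<close>

lemma quantization_lower_bound:
  assumes "finite \<beta>" "\<beta> \<noteq> {}"
  shows "(17 * 2 ^ l - 8 * real (card \<beta>)) / (72 * 18 ^ l) \<le> L (sqd \<beta>)"
  using assms
proof (induction l arbitrary: \<beta>)
  case 0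
  show ?case
  proof (cases "card \<beta> \<le> 3")
    case True
    with at_most_three_points(1) 0 show ?thesis by simp
  next
    case False
    then have "(17 - 8 * real (card \<beta>)) / 72 \<le> 0" by simp
    also have "0 \<le> L (sqd \<beta>)"
      using cell_nonneg[OF 0, of 1 0] by simp
    finally show ?thesis by simp
  qed
next
  case (Suc l)
  show ?case
  \<comment> \<open>With at most three points the line at level 1 is at least
    \<open>5 / 648\<close>, more than the \<open>1 / 288\<close> that the gap alternative
    yields.\<close>
  proof (cases "l = 0 \<and> card \<beta> \<le> 3")
    case True
    with at_most_three_points(2) Suc.prems show ?thesis by simp
  next
    case False
    from gap_or_separated[OF Suc.prems] show ?thesis
    proof cases
      case 1
      \<comment> \<open>From four points on, the line at level 1 is at most \<open>1 / 648\<close>;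
        from level 2 on, the lines stay below \<open>1 / 288\<close> even at cardinality 0.\<close>
      have "(17 * 2 ^ Suc l - 8 * real (card \<beta>)) / (72 * 18 ^ Suc l) \<le> 1 / 288"
      proof (cases "l = 0")
        case True
        with False have "4 \<le> card \<beta>" by simp
        with True show ?thesis by simp
      next
        case False
        then obtain m where l: "l = Suc m" by (cases l) auto
        have "(2::real) ^ m \<le> 18 ^ m" by (rule power_mono) auto
        moreover have "0 \<le> (18::real) ^ m" by simp
        ultimately have "272 * (2::real) ^ m \<le> 324 * 18 ^ m"
          by linarith
        then show ?thesis unfolding l by (simp add: field_simps)
      qed
      with 1 show ?thesis by linarith
    next
      case (2 \<beta>1 \<beta>2)
      have "(17 * 2 ^ Suc l - 8 * real (card \<beta>)) / (72 * 18 ^ Suc l)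
        = ((17 * 2 ^ l - 8 * real (card \<beta>1)) / (72 * 18 ^ l)
         + (17 * 2 ^ l - 8 * real (card \<beta>2)) / (72 * 18 ^ l)) / 18"
        unfolding 2(5)[symmetric] by (simp add: field_simps)
      also have "\<dots> \<le> (L (sqd \<beta>1) + L (sqd \<beta>2)) / 18"
        by (intro divide_right_mono add_mono Suc.IH 2) simp
      finally show ?thesis using 2(6) by linarith
    qed
  qed
qed

end

section \<open>Cells of the Cantor set\<close>

lemma words_0: "words 0 = {[]}"
  by (auto simp: words_def)

lemma words_Suc: "words (Suc k) = Cons 1 ` words k \<union> Cons 2 ` words k"
  by (auto simp: words_def length_Suc_conv)

lemma finite_words: "finite (words k)"
  by (induction k) (auto simp: words_0 words_Suc)

lemma card_words: "card (words k) = 2 ^ k"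
proof (induction k)
  case (Suc k)
  have "card (words (Suc k)) = card (Cons 1 ` words k) + card (Cons 2 ` words k)"
    unfolding words_Suc by (rule card_Un_disjoint) (auto simp: finite_words)
  then show ?case
    by (simp add: card_image Suc)
qed (simp add: words_0)

lemma Tw_append: "Tw (\<sigma> @ \<tau>) x = Tw \<sigma> (Tw \<tau> x)"
  by (induction \<sigma>) (auto simp: Tw_def)

text \<open>Expanding around the mean \<open>1 / 2\<close> exhibits \<open>aw \<sigma>\<close> as
  the mean of its cell, as \<open>Tw_square\<close> uses.\<close>

lemma Tw_eq: "Tw \<sigma> x = aw \<sigma> + (x - 1 / 2) / 3 ^ length \<sigma>"
proof (induction \<sigma> arbitrary: x)
  case (Cons i \<sigma>)
  have "Tw (i # \<sigma>) y = Tmap i (Tw \<sigma> y)" for y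
    by (simp add: Tw_def)
  then show ?case
    using Cons[of x] by (simp add: aw_def Tmap_def T1_def T2_def add_divide_distrib)
qed (simp add: Tw_def aw_def)

lemma Tw_unit_interval:
  assumes "0 \<le> x" "x \<le> 1"
  shows "0 \<le> Tw \<sigma> x \<and> Tw \<sigma> x \<le> 1"
  by (induction \<sigma>) (use assms in \<open>auto simp: Tw_def Tmap_def T1_def T2_def\<close>)

lemma continuous_Tw: "continuous_on A (Tw \<sigma>)"
proof -
  have "Tw \<sigma> = (\<lambda>x. aw \<sigma> + (x - 1 / 2) / 3 ^ length \<sigma>)"
    using Tw_eq by blast
  then show ?thesis
    by (auto intro!: continuous_intros)
qed

context cantor_functional
begin

lemma split_words:
  assumes "continuous_on UNIV f"
  shows "L f = (\<Sum>\<sigma>\<in>words k. 1 / 2 ^ k * L (\<lambda>x. f (Tw \<sigma> x)))"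
  using assms
proof (induction k arbitrary: f)
  case (Suc k)
  note [continuous_intros] = continuous_on_compose2[OF Suc.prems]
  have "L (\<lambda>x. f (x / 3)) = (\<Sum>\<sigma>\<in>words k. 1 / 2 ^ k * L (\<lambda>x. f (Tw \<sigma> x / 3)))"
    by (rule Suc.IH) (auto intro!: continuous_intros)
  moreover have "L (\<lambda>x. f (x / 3 + 2 / 3)) = (\<Sum>\<sigma>\<in>words k. 1 / 2 ^ k * L (\<lambda>x. f (Tw \<sigma> x / 3 + 2 / 3)))"
    by (rule Suc.IH) (auto intro!: continuous_intros)
  moreover have "(\<Sum>\<sigma>\<in>words (Suc k). 1 / 2 ^ Suc k * L (\<lambda>x. f (Tw \<sigma> x)))
      = (\<Sum>\<sigma>\<in>words k. 1 / 2 ^ Suc k * L (\<lambda>x. f (Tw \<sigma> x / 3)))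
      + (\<Sum>\<sigma>\<in>words k. 1 / 2 ^ Suc k * L (\<lambda>x. f (Tw \<sigma> x / 3 + 2 / 3)))"
    unfolding words_Suc
    by (subst sum.union_disjoint)
       (auto simp: finite_words sum.reindex Tw_def Tmap_def T1_def T2_def)
  ultimately show ?case
    by (subst self_similar[OF Suc.prems])
       (simp add: sum_distrib_left sum_divide_distrib add_divide_distrib mult.commute)
qed (simp add: words_0 Tw_def)

text \<open>Splitting the cells of \<open>I\<close> once more yields, for \<open>k = ell n\<close>,
  one cell per centre listed in \<open>alpha n I\<close>.\<close>

lemma split_partition:
  assumes f: "continuous_on UNIV f" and I: "I \<subseteq> words k"
  shows "L f = (\<Sum>\<sigma>\<in>words k - I. 1 / 2 ^ k * L (\<lambda>x. f (Tw \<sigma> x)))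
    + (\<Sum>\<sigma>\<in>I. 1 / 2 ^ (k + 1) * (L (\<lambda>x. f (Tw (\<sigma> @ [1]) x)) + L (\<lambda>x. f (Tw (\<sigma> @ [2]) x))))"
proof -
  have "L (\<lambda>x. f (Tw \<sigma> x)) = (L (\<lambda>x. f (Tw (\<sigma> @ [1]) x)) + L (\<lambda>x. f (Tw (\<sigma> @ [2]) x))) / 2" for \<sigma>
    by (subst self_similar)
       (auto simp: Tw_append Tw_def[of "[i]" for i] Tmap_def T1_def T2_def
         intro!: continuous_on_compose2[OF f] continuous_Tw)
  then have "(\<Sum>\<sigma>\<in>I. 1 / 2 ^ k * L (\<lambda>x. f (Tw \<sigma> x)))
      = (\<Sum>\<sigma>\<in>I. 1 / 2 ^ (k + 1) * (L (\<lambda>x. f (Tw (\<sigma> @ [1]) x)) + L (\<lambda>x. f (Tw (\<sigma> @ [2]) x))))"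
    by (intro sum.cong refl) (simp add: field_simps)
  then show ?thesis
    unfolding split_words[OF f, of k] sum.subset_diff[OF I finite_words] by simp
qed

lemma Tw_square: "L (\<lambda>x. (Tw \<sigma> x - q)\<^sup>2) = 1 / (8 * 9 ^ length \<sigma>) + (aw \<sigma> - q)\<^sup>2"
proof -
  have "Tw \<sigma> x - q = (1 / 3 ^ length \<sigma>) * x + (aw \<sigma> - q - 1 / (2 * 3 ^ length \<sigma>))" for x
    by (simp add: Tw_eq[of \<sigma> x] field_simps)
  then have "L (\<lambda>x. (Tw \<sigma> x - q)\<^sup>2)
      = L (\<lambda>x. ((1 / 3 ^ length \<sigma>) * x + (aw \<sigma> - q - 1 / (2 * 3 ^ length \<sigma>)))\<^sup>2)"
    by presburger
  also have "\<dots> = (1 / 3 ^ length \<sigma>)\<^sup>2 / 8 + (aw \<sigma> - q)\<^sup>2"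
    unfolding square by (simp add: power2_eq_square field_simps)
  also have "(1 / (3::real) ^ length \<sigma>)\<^sup>2 = 1 / 9 ^ length \<sigma>"
    by (simp add: power_divide power2_eq_square flip: power_mult_distrib)
  finally show ?thesis
    by simp
qed

text \<open>Used with \<open>h = 0\<close> for the quantization error itself and with \<open>h \<sigma> = (aw \<sigma> + 1 / n)\<^sup>2\<close>
  for the term that is independent of the points.\<close>

lemma partition_variance:
  fixes h :: "nat list \<Rightarrow> real"
  assumes I: "I \<subseteq> words k" and n: "card I = n - 2 ^ k" "2 ^ k \<le> n"
  shows "(\<Sum>\<sigma>\<in>words k - I. 1 / 2 ^ k * (1 / (8 * 9 ^ length \<sigma>) + h \<sigma>))
      + (\<Sum>\<sigma>\<in>I. 1 / 2 ^ (k + 1) * ((1 / (8 * 9 ^ length (\<sigma> @ [1::nat])) + h (\<sigma> @ [1]))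
                                  + (1 / (8 * 9 ^ length (\<sigma> @ [2::nat])) + h (\<sigma> @ [2]))))
    = 1 / 18 ^ k * (1 / 8) * (2 ^ (k + 1) - real n + 1 / 9 * (real n - 2 ^ k))
      + ((\<Sum>\<sigma>\<in>words k - I. 1 / 2 ^ k * h \<sigma>)
      + (\<Sum>\<sigma>\<in>I. 1 / 2 ^ (k + 1) * (h (\<sigma> @ [1]) + h (\<sigma> @ [2]))))"
proof -
  have len: "length \<sigma> = k" if "\<sigma> \<in> words k" for \<sigma>
    using that by (simp add: words_def)
  have p: "(18::real) ^ k = 2 ^ k * 9 ^ k"
    by (simp flip: power_mult_distrib)
  have cI: "real (card I) = real n - 2 ^ k"
    using n by (simp add: of_nat_diff)
  have "card (words k - I) = 2 ^ k - card I"
    using I by (simp add: card_Diff_subset finite_subset[OF _ finite_words] card_words)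
  moreover have "card I \<le> 2 ^ k"
    using card_mono[OF finite_words I] by (simp add: card_words)
  ultimately have cJ: "real (card (words k - I)) = 2 ^ (k + 1) - real n"
    using cI by (simp add: of_nat_diff)
  have "(\<Sum>\<sigma>\<in>words k - I. 1 / 2 ^ k * (1 / (8 * 9 ^ length \<sigma>) + h \<sigma>))
      = (\<Sum>\<sigma>\<in>words k - I. 1 / (8 * 18 ^ k) + 1 / 2 ^ k * h \<sigma>)"
    by (rule sum.cong) (auto simp: len p field_simps)
  also have "\<dots> = (2 ^ (k + 1) - real n) / (8 * 18 ^ k) + (\<Sum>\<sigma>\<in>words k - I. 1 / 2 ^ k * h \<sigma>)"
    by (simp add: sum.distrib cJ)
  finally have 1: "(\<Sum>\<sigma>\<in>words k - I. 1 / 2 ^ k * (1 / (8 * 9 ^ length \<sigma>) + h \<sigma>)) = \<dots>" .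
  have "(\<Sum>\<sigma>\<in>I. 1 / 2 ^ (k + 1) * ((1 / (8 * 9 ^ length (\<sigma> @ [1::nat])) + h (\<sigma> @ [1]))
                                  + (1 / (8 * 9 ^ length (\<sigma> @ [2::nat])) + h (\<sigma> @ [2]))))
      = (\<Sum>\<sigma>\<in>I. 1 / (72 * 18 ^ k) + 1 / 2 ^ (k + 1) * (h (\<sigma> @ [1]) + h (\<sigma> @ [2])))"
    using I by (intro sum.cong) (auto simp: len p field_simps subset_iff)
  also have "\<dots> = (real n - 2 ^ k) / (72 * 18 ^ k)
      + (\<Sum>\<sigma>\<in>I. 1 / 2 ^ (k + 1) * (h (\<sigma> @ [1]) + h (\<sigma> @ [2])))"
    by (simp add: sum.distrib cI)
  finally have 2: "(\<Sum>\<sigma>\<in>I. 1 / 2 ^ (k + 1) * ((1 / (8 * 9 ^ length (\<sigma> @ [1::nat])) + h (\<sigma> @ [1]))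
                                  + (1 / (8 * 9 ^ length (\<sigma> @ [2::nat])) + h (\<sigma> @ [2])))) = \<dots>" .
  have "(2 ^ (k + 1) - real n) / (8 * 18 ^ k) + (real n - 2 ^ k) / (72 * 18 ^ k)
      = 1 / 18 ^ k * (1 / 8) * (2 ^ (k + 1) - real n + 1 / 9 * (real n - 2 ^ k))"
    by (simp add: field_simps)
  then show ?thesis
    unfolding 1 2 by linarith
qed

end

section \<open>Integration against the Cantor distribution\<close>

text \<open>Extends the invariance from sets to nonnegative functions by the standard induction. The
  factor 2 on the left avoids division in \<open>ennreal\<close>.\<close>

lemma nn_integral_self_similar:
  assumes P: "is_cantor_dist P" and f: "f \<in> borel_measurable borel"
  shows "2 * (\<integral>\<^sup>+ x. f x \<partial>P) = (\<integral>\<^sup>+ x. f (T1 x) \<partial>P) + (\<integral>\<^sup>+ x. f (T2 x) \<partial>P)"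
proof -
  interpret prob_space P
    using P by (simp add: is_cantor_dist_def)
  have sets[measurable_cong]: "sets P = sets borel"
    using P by (simp add: is_cantor_dist_def)
  have T[measurable]: "T1 \<in> borel_measurable borel" "T2 \<in> borel_measurable borel"
    unfolding T1_def T2_def by measurable
  show ?thesis
    using f
  proof (induction f rule: borel_measurable_induct)
    case (cong f g)
    then show ?case by (simp add: space_borel)
  next
    case (set A)
    have [measurable]: "A \<in> sets borel" using set by simp
    have "measure P A = measure (distr P borel T1) A / 2 + measure (distr P borel T2) A / 2"
      using P set by (simp add: is_cantor_dist_def)
    then have "ennreal (2 * measure P A) = ennreal (measure (distr P borel T1) A + measure (distr P borel T2) A)"
      by (simp add: field_simps)
    then have "2 * emeasure P A = emeasure (distr P borel T1) A + emeasure (distr P borel T2) A"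
      by (simp add: emeasure_eq_measure ennreal_mult ennreal_plus emeasure_distr measure_distr)
    moreover have "emeasure (distr P borel T) A = (\<integral>\<^sup>+ x. indicator A (T x) \<partial>P)"
      if [measurable]: "T \<in> borel_measurable borel" for T
      using nn_integral_distr[of T P borel "indicator A"] by simp
    ultimately show ?case
      by simp
  next
    case (mult u c)
    then have [measurable]: "u \<in> borel_measurable borel" by simp
    show ?case
      using mult(4) by (simp add: nn_integral_cmult distrib_left[symmetric] mult.left_commute)
  next
    case (add u v)
    then have [measurable]: "u \<in> borel_measurable borel" "v \<in> borel_measurable borel" by simp_all
    show ?case
      using add by (simp add: nn_integral_add distrib_left add_ac)
  next
    case (seq F)
    have [measurable]: "F i \<in> borel_measurable borel" for i using seq by simp
    have sup: "(\<integral>\<^sup>+ x. (SUP i. F i) (T x) \<partial>P) = (SUP i. \<integral>\<^sup>+ x. F i (T x) \<partial>P)"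
      if [measurable]: "T \<in> borel_measurable borel" for T
      unfolding SUP_apply using \<open>incseq F\<close>
      by (intro nn_integral_monotone_convergence_SUP) (auto simp: incseq_def le_fun_def)
    have inc: "incseq (\<lambda>i. \<integral>\<^sup>+ x. F i (T x) \<partial>P)" for T
      using \<open>incseq F\<close> by (auto simp: incseq_def le_fun_def intro!: nn_integral_mono)
    have "2 * (\<integral>\<^sup>+ x. (SUP i. F i) x \<partial>P) = (SUP i. 2 * (\<integral>\<^sup>+ x. F i x \<partial>P))"
      using sup[of "\<lambda>x. x"] by (simp add: SUP_mult_left_ennreal)
    also have "\<dots> = (SUP i. (\<integral>\<^sup>+ x. F i (T1 x) \<partial>P) + (\<integral>\<^sup>+ x. F i (T2 x) \<partial>P))"
      using seq by simp
    also have "\<dots> = (SUP i. \<integral>\<^sup>+ x. F i (T1 x) \<partial>P) + (SUP i. \<integral>\<^sup>+ x. F i (T2 x) \<partial>P)"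
      by (rule ennreal_SUP_add) (rule inc)+
    finally show ?case
      unfolding sup[OF T(1)] sup[OF T(2)] .
  qed
qed

lemma AE_unit_interval:
  assumes P: "is_cantor_dist P"
  shows "AE x in P. 0 \<le> x \<and> x \<le> 1"
proof -
  interpret prob_space P
    using P by (simp add: is_cantor_dist_def)
  have sets[measurable_cong]: "sets P = sets borel"
    using P by (simp add: is_cantor_dist_def)
  have space: "space P = UNIV"
    using sets_eq_imp_space_eq[OF sets] by simp
  have [measurable]: "T1 \<in> borel_measurable borel" "T2 \<in> borel_measurable borel"
    unfolding T1_def T2_def by measurable
  \<comment> \<open>Both maps contract towards \<open>[0, 1]\<close> by the factor 3, so the mass at distance \<open>t\<close> from it
    is at most the mass at distance \<open>3 * t\<close>.\<close>
  define A where "A t = {x::real. x < - t \<or> 1 + t < x}" for t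
  have [measurable]: "A t \<in> sets borel" for t
    unfolding A_def by measurable
  have anti: "A t \<subseteq> A s" if "s \<le> t" for s t
    using that by (auto simp: A_def)
  have step: "measure P (A t) \<le> measure P (A (3 * t))" if "t > 0" for t
  proof -
    have "measure P (A t) = measure P (T1 -` A t) / 2 + measure P (T2 -` A t) / 2"
      using P by (simp add: is_cantor_dist_def measure_distr space)
    moreover have "measure P (T1 -` A t) \<le> measure P (A (3 * t))"
      "measure P (T2 -` A t) \<le> measure P (A (3 * t))"
      using that by (intro finite_measure_mono; auto simp: A_def T1_def T2_def)+
    ultimately show ?thesis by simp
  qed
  have null: "measure P (A t) = 0" if t: "t > 0" for t
  proof -
    have "measure P (A t) \<le> measure P (A (3 ^ k * t))" for k
    proof (induction k)
      case (Suc k)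
      also have "measure P (A (3 ^ k * t)) \<le> measure P (A (3 * (3 ^ k * t)))"
        using t by (intro step) simp
      finally show ?case by (simp add: mult.assoc)
    qed simp
    \<comment> \<open>The bound holds for every \<open>k\<close> and the sets decrease to the empty
      set, so continuity from above forces measure 0.\<close>
    moreover have "(\<lambda>k. measure P (A (3 ^ k * t))) \<longlonglongrightarrow> measure P (\<Inter>k. A (3 ^ k * t))"
    proof (rule finite_Lim_measure_decseq)
      show "decseq (\<lambda>k. A (3 ^ k * t))"
      proof (rule decseq_SucI)
        fix k
        have "3 ^ k * t \<le> 3 ^ Suc k * t" using t by simp
        then show "A (3 ^ Suc k * t) \<le> A (3 ^ k * t)" by (rule anti)
      qed
    qed auto
    moreover have "(\<Inter>k. A (3 ^ k * t)) = {}"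
    proof -
      have "\<exists>k. x \<notin> A (3 ^ k * t)" for x
      proof -
        obtain k where "\<bar>x\<bar> / t < 3 ^ k"
          using real_arch_pow[of 3 "\<bar>x\<bar> / t"] by auto
        then have "\<bar>x\<bar> < 3 ^ k * t"
          using t by (simp add: field_simps)
        then show ?thesis by (intro exI[of _ k]) (auto simp: A_def)
      qed
      then show ?thesis by auto
    qed
    ultimately have "measure P (A t) \<le> 0"
      by (intro LIMSEQ_le_const) auto
    then show ?thesis
      using measure_nonneg[of P "A t"] by linarith
  qed
  \<comment> \<open>The complement of \<open>[0, 1]\<close> is the countable union of these
    sets.\<close>
  have "AE x in P. x \<notin> A (1 / real (Suc m))" for m
    using null[of "1 / real (Suc m)"]
    by (intro AE_not_in) (auto simp: null_sets_def emeasure_eq_measure)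
  then have "AE x in P. \<forall>m. x \<notin> A (1 / real (Suc m))"
    by (simp add: AE_all_countable)
  then show ?thesis
  proof eventually_elim
    case (elim x)
    show ?case
    proof (rule ccontr)
      assume "\<not> (0 \<le> x \<and> x \<le> 1)"
      then have "0 < max (- x) (x - 1)" by auto
      then obtain m where "1 / real (Suc m) < max (- x) (x - 1)"
        using nat_approx_posE by blast
      with elim[rule_format, of m] show False
        by (auto simp: A_def)
    qed
  qed
qed

lemma integrable_continuous:
  fixes f :: "real \<Rightarrow> real"
  assumes P: "is_cantor_dist P" and f: "continuous_on UNIV f"
  shows "integrable P f"
proof -
  interpret prob_space P
    using P by (simp add: is_cantor_dist_def)
  have sets[measurable_cong]: "sets P = sets borel"
    using P by (simp add: is_cantor_dist_def)
  have "compact (f ` {0..1})"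
    by (intro compact_continuous_image continuous_on_subset[OF f]) auto
  then obtain B where "\<forall>x\<in>f ` {0..1}. norm x \<le> B"
    using compact_imp_bounded bounded_iff by blast
  then have "AE x in P. norm (f x) \<le> B"
    by (intro eventually_mono[OF AE_unit_interval[OF P]]) auto
  moreover have "f \<in> borel_measurable P"
    using borel_measurable_continuous_onI[OF f] by simp
  ultimately show ?thesis
    by (rule integrable_const_bound)
qed

lemma cantor_functional_integral:
  assumes P: "is_cantor_dist P"
  shows "cantor_functional (\<lambda>f. \<integral>x. f x \<partial>P)"
proof
  interpret prob_space P
    using P by (simp add: is_cantor_dist_def)
  note int = integrable_continuous[OF P]
  show "(\<integral>x. f x + g x \<partial>P) = (\<integral>x. f x \<partial>P) + (\<integral>x. g x \<partial>P)"
    if "continuous_on UNIV f" "continuous_on UNIV g" for f g :: "real \<Rightarrow> real"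
    using that by (simp add: int)
  show "(\<integral>x. c * f x \<partial>P) = c * (\<integral>x. f x \<partial>P)" for f :: "real \<Rightarrow> real" and c
    by simp
  show "(\<integral>x. f x \<partial>P) \<le> (\<integral>x. g x \<partial>P)"
    if "continuous_on UNIV f" "continuous_on UNIV g" "\<And>x. 0 \<le> x \<Longrightarrow> x \<le> 1 \<Longrightarrow> f x \<le> g x"
    for f g :: "real \<Rightarrow> real"
    using that by (intro integral_mono_AE int eventually_mono[OF AE_unit_interval[OF P]]) auto
  show "(\<integral>x. 1 \<partial>P) = (1::real)"
    by (simp add: prob_space)
  show "(\<integral>x. f x \<partial>P) = ((\<integral>x. f (x / 3) \<partial>P) + (\<integral>x. f (x / 3 + 2 / 3) \<partial>P)) / 2"
    if f: "continuous_on UNIV f" for f :: "real \<Rightarrow> real"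
  proof -
    have i: "integrable P f" "integrable P (\<lambda>x. f (x / 3))" "integrable P (\<lambda>x. f (x / 3 + 2 / 3))"
      by (auto intro!: int f continuous_on_compose2[OF f] continuous_intros)
    \<comment> \<open>\<open>ennreal\<close> cuts negative values to 0, so \<open>g = f\<close> and
      \<open>g = - f\<close> give the positive and the negative part of \<open>f\<close>.\<close>
    have half: "2 * enn2real (\<integral>\<^sup>+ x. ennreal (g x) \<partial>P)
        = enn2real (\<integral>\<^sup>+ x. ennreal (g (x / 3)) \<partial>P) + enn2real (\<integral>\<^sup>+ x. ennreal (g (x / 3 + 2 / 3)) \<partial>P)"
      if g: "continuous_on UNIV g" for g :: "real \<Rightarrow> real"
    proof -
      have "(\<integral>\<^sup>+ x. ennreal (h x) \<partial>P) < top" if "continuous_on UNIV h" for h :: "real \<Rightarrow> real"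
      proof -
        have "(\<integral>\<^sup>+ x. ennreal (h x) \<partial>P) \<le> (\<integral>\<^sup>+ x. ennreal (norm (h x)) \<partial>P)"
          by (intro nn_integral_mono ennreal_leI) auto
        also have "\<dots> < top"
          using int[OF that] by (simp add: integrable_iff_bounded)
        finally show ?thesis .
      qed
      moreover have "continuous_on UNIV (\<lambda>x. g (x / 3))" "continuous_on UNIV (\<lambda>x. g (x / 3 + 2 / 3))"
        by (auto intro!: continuous_on_compose2[OF g] continuous_intros)
      ultimately have "enn2real ((\<integral>\<^sup>+ x. ennreal (g (x / 3)) \<partial>P) + (\<integral>\<^sup>+ x. ennreal (g (x / 3 + 2 / 3)) \<partial>P))
        = enn2real (\<integral>\<^sup>+ x. ennreal (g (x / 3)) \<partial>P) + enn2real (\<integral>\<^sup>+ x. ennreal (g (x / 3 + 2 / 3)) \<partial>P)"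
        by (intro enn2real_plus) auto
      moreover have "2 * (\<integral>\<^sup>+ x. ennreal (g x) \<partial>P)
          = (\<integral>\<^sup>+ x. ennreal (g (x / 3)) \<partial>P) + (\<integral>\<^sup>+ x. ennreal (g (x / 3 + 2 / 3)) \<partial>P)"
        using nn_integral_self_similar[OF P, of "\<lambda>x. ennreal (g x)"] borel_measurable_continuous_onI[OF g]
        by (simp add: T1_def T2_def)
      moreover have "enn2real (2 * (\<integral>\<^sup>+ x. ennreal (g x) \<partial>P)) = 2 * enn2real (\<integral>\<^sup>+ x. ennreal (g x) \<partial>P)"
        by (simp add: enn2real_mult)
      ultimately show ?thesis by simp
    qed
    show ?thesis
      using half[OF f] half[of "\<lambda>x. - f x"] f
      by (simp add: real_lebesgue_integral_def i continuous_on_minus)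
  qed
qed

section \<open>Constrained quantization\<close>

text \<open>\<open>ell\<close> is defined by \<open>THE\<close>, so the exponent must first be shown
  to be unique.\<close>

lemma two_power_ell_le:
  assumes "1 \<le> n"
  shows "2 ^ ell n \<le> n"
proof -
  obtain l where l: "2 ^ l \<le> n" "n < 2 ^ (l + 1)"
    using ex_power_ivl1[of 2 n] assms by auto
  have "l' = l" if "2 ^ l' \<le> n \<and> n < 2 ^ (l' + 1)" for l'
  proof -
    have "(2::nat) ^ l' < 2 ^ (l + 1)" "(2::nat) ^ l < 2 ^ (l' + 1)"
      using that l by linarith+
    then have "l' < l + 1" "l < l' + 1"
      by (simp_all only: power_strict_increasing_iff one_less_numeral_iff semiring_norm)
    then show ?thesis by simp
  qed
  then have "ell n = l"
    unfolding ell_def using l by (intro the_equality conjI)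
  with l show ?thesis by simp
qed

section \<open>Optimal points and matching bounds\<close>

text \<open>For \<open>k = ell n\<close> these are the values of \<open>U n\<close> on
  \<open>alpha n I\<close>.\<close>

definition centers :: "nat \<Rightarrow> nat list set \<Rightarrow> real set" where
  "centers k I = aw ` (words k - I) \<union> (\<lambda>\<sigma>. aw (\<sigma> @ [1])) ` I \<union> (\<lambda>\<sigma>. aw (\<sigma> @ [2])) ` I"

lemma
  assumes I: "I \<subseteq> words k" and n: "card I = n - 2 ^ k" "2 ^ k \<le> n"
  shows finite_centers: "finite (centers k I)"
    and centers_nonempty: "centers k I \<noteq> {}"
    and card_centers: "card (centers k I) \<le> n"
proof -
  have fin: "finite I" "finite (words k)"
    using I finite_words finite_subset by blast+
  then show "finite (centers k I)"
    by (simp add: centers_def)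
  have "words k \<noteq> {}"
    using card_words[of k] by auto
  then show "centers k I \<noteq> {}"
    by (auto simp: centers_def)
  have "card (centers k I) \<le> card (words k - I) + card I + card I"
    unfolding centers_def using fin
    by (intro card_Un_le[THEN order_trans] add_mono card_image_le) auto
  also have "card (words k - I) = 2 ^ k - card I"
    using fin I by (simp add: card_Diff_subset card_words)
  also have "card I \<le> 2 ^ k"
    using card_mono[OF fin(2) I] by (simp add: card_words)
  then have "2 ^ k - card I + card I + card I = n"
    using n by simp
  finally show "card (centers k I) \<le> n" .
qed

text \<open>Each cell is charged to its own centre instead of the nearest one. The terms
  \<open>+ 0\<close> fit \<open>partition_variance\<close> with \<open>h = 0\<close>.\<close>

lemma (in cantor_functional) centers_upper_bound:
  assumes I: "I \<subseteq> words k" and n: "card I = n - 2 ^ k" "2 ^ k \<le> n"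
  shows "L (sqd (centers k I))
    \<le> 1 / 18 ^ k * (1 / 8) * (2 ^ (k + 1) - real n + 1 / 9 * (real n - 2 ^ k))"
proof -
  let ?C = "centers k I"
  note fin = finite_centers[OF assms] and ne = centers_nonempty[OF assms]
  have cell: "L (\<lambda>x. sqd ?C (Tw \<sigma> x)) \<le> 1 / (8 * 9 ^ length \<sigma>) + 0" if "aw \<sigma> \<in> ?C" for \<sigma>
  proof -
    have "L (\<lambda>x. sqd ?C (Tw \<sigma> x)) \<le> L (\<lambda>x. (Tw \<sigma> x - aw \<sigma>)\<^sup>2)"
      using fin ne that by (intro mono continuous_intros continuous_Tw sqd_le) auto
    then show ?thesis by (simp add: Tw_square)
  qed
  have "L (sqd ?C) \<le> (\<Sum>\<sigma>\<in>words k - I. 1 / 2 ^ k * (1 / (8 * 9 ^ length \<sigma>) + 0))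
      + (\<Sum>\<sigma>\<in>I. 1 / 2 ^ (k + 1) * ((1 / (8 * 9 ^ length (\<sigma> @ [1::nat])) + 0)
                                  + (1 / (8 * 9 ^ length (\<sigma> @ [2::nat])) + 0)))"
    unfolding split_partition[OF continuous_sqd[OF fin ne continuous_on_id] I]
    by (intro add_mono sum_mono mult_left_mono cell) (auto simp: centers_def)
  also have "\<dots> = 1 / 18 ^ k * (1 / 8) * (2 ^ (k + 1) - real n + 1 / 9 * (real n - 2 ^ k))"
    using partition_variance[OF assms, of "\<lambda>_. 0"] by simp
  finally show ?thesis .
qed

text \<open>The closed formula is the supporting line at level \<open>k\<close>, evaluated at
  \<open>n\<close>. It decreases in \<open>n\<close>, which covers sets with fewer points.\<close>

lemma (in cantor_functional) quantization_lower_bound_formula: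
  assumes "finite \<beta>" "\<beta> \<noteq> {}" "card \<beta> \<le> n"
  shows "1 / 18 ^ k * (1 / 8) * (2 ^ (k + 1) - real n + 1 / 9 * (real n - 2 ^ k)) \<le> L (sqd \<beta>)"
proof -
  have "1 / 18 ^ k * (1 / 8) * (2 ^ (k + 1) - real n + 1 / 9 * (real n - 2 ^ k))
      = (17 * 2 ^ k - 8 * real n) / (72 * 18 ^ k)"
    by (simp add: field_simps)
  also have "\<dots> \<le> (17 * 2 ^ k - 8 * real (card \<beta>)) / (72 * 18 ^ k)"
    using assms(3) by (intro divide_right_mono) auto
  finally show ?thesis
    using quantization_lower_bound[OF assms(1,2), of k] by linarith
qed

section \<open>Reduction to the unconstrained problem\<close>

text \<open>This is \<open>s\<^sup>2 + t\<^sup>2 = ((s - t)\<^sup>2 + (s + t)\<^sup>2) / 2\<close>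
  with \<open>s = x - fst pq\<close> and \<open>t = snd pq\<close>, a rotation by 45
  degrees.\<close>

lemma rho_eq: "rho x pq = ((x - (fst pq + snd pq))\<^sup>2 + (x + (snd pq - fst pq))\<^sup>2) / 2"
  by (simp add: rho_def power2_eq_square field_simps)

lemma rho_Uinv: "rho x (Uinv n u) = ((x - u)\<^sup>2 + (x + 1 / real n)\<^sup>2) / 2"
  by (simp add: rho_eq Uinv_def add_divide_distrib diff_divide_distrib)

lemma Verr_axis: "Verr P ((\<lambda>u. (u, 0)) ` \<beta>) = (\<integral>x. sqd \<beta> x \<partial>P)"
  by (simp add: Verr_def sqd_def rho_def image_image)

lemma U_Uinv: "U n (Uinv n u) = u"
proof -
  have "2 * ((u - z) / 2) + z = u" for z :: real
    by (simp add: field_simps)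
  then show ?thesis
    by (simp only: U_def Uinv_def fst_conv)
qed

lemma alpha_eq_centers: "alpha n I = Uinv n ` centers (ell n) I"
  by (simp add: alpha_def centers_def image_Un image_image)

lemma Uinv_in_S:
  assumes "0 \<le> u" "u \<le> 1"
  shows "Uinv n u \<in> S n"
proof -
  have "0 \<le> 1 / real n" "- 1 / real n = - (1 / real n)"
    by simp_all
  then show ?thesis
    using assms unfolding Uinv_def S_def mem_Collect_eq case_prod_conv by argo
qed

theorem mainTheorem6:
  fixes P :: "real measure" and n :: nat and I :: "nat list set"
  assumes "is_cantor_dist P"
    and "n \<ge> 2"
    and "I \<subseteq> words (ell n)"
    and "card I = n - 2 ^ ell n"
  shows "constr_optimal P n (alpha n I)
    \<and> Vc P n = Verr P (alpha n I)
    \<and> Verr P (alpha n I) =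
        1 / 18 ^ ell n * (1 / 8) * (2 ^ (ell n + 1) - real n + 1 / 9 * (real n - 2 ^ ell n))
        + Aterm n I
    \<and> 1 / 18 ^ ell n * (1 / 8) * (2 ^ (ell n + 1) - real n + 1 / 9 * (real n - 2 ^ ell n))
        = Verr P ((\<lambda>a. (U n a, 0)) ` alpha n I)
    \<and> 1 / 18 ^ ell n * (1 / 8) * (2 ^ (ell n + 1) - real n + 1 / 9 * (real n - 2 ^ ell n))
        = Vu P n"
proof -
  define L :: "(real \<Rightarrow> real) \<Rightarrow> real" where "L = (\<lambda>f. \<integral>x. f x \<partial>P)"
  interpret cantor_functional L
    unfolding L_def by (rule cantor_functional_integral[OF assms(1)])
  define G where "G = 1 / 18 ^ ell n * (1 / 8) * (2 ^ (ell n + 1) - real n + 1 / 9 * (real n - 2 ^ ell n))"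
  define C where "C = centers (ell n) I"
  \<comment> \<open>Twice the part of the error that is the same for all choices of points on
    \<open>S n\<close>.\<close>
  define Q where "Q = L (\<lambda>x. (x + 1 / real n)\<^sup>2)"
  have n1: "1 \<le> n" using assms(2) by simp
  note I = assms(3,4) two_power_ell_le[OF n1]
  have C: "finite C" "C \<noteq> {}" "card C \<le> n"
    unfolding C_def using finite_centers[OF I] centers_nonempty[OF I] card_centers[OF I] by auto
  have alpha: "alpha n I = Uinv n ` C"
    by (simp add: alpha_eq_centers C_def)
  have lower: "G \<le> L (sqd \<beta>)" if "finite \<beta>" "\<beta> \<noteq> {}" "card \<beta> \<le> n" for \<beta>
    unfolding G_def by (rule quantization_lower_bound_formula[OF that])
  have LC: "L (sqd C) = G"
    using lower[OF C] centers_upper_bound[OF I] unfolding C_def G_def by linarith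
  have Verr_mixed: "L (\<lambda>x. (sqd \<beta> x + (x + 1 / real n)\<^sup>2) / 2) = (L (sqd \<beta>) + Q) / 2"
    if "finite \<beta>" "\<beta> \<noteq> {}" for \<beta>
  proof -
    have "L (\<lambda>x. (1 / 2) * (sqd \<beta> x + (x + 1 / real n)\<^sup>2)) = (1 / 2) * L (\<lambda>x. sqd \<beta> x + (x + 1 / real n)\<^sup>2)"
      using that by (intro scale continuous_intros) auto
    also have "L (\<lambda>x. sqd \<beta> x + (x + 1 / real n)\<^sup>2) = L (sqd \<beta>) + Q"
      unfolding Q_def using that by (intro add continuous_intros) auto
    finally show ?thesis by simp
  qed

  have Verr_alpha: "Verr P (alpha n I) = (G + Q) / 2"
  proof -
    have "Min ((\<lambda>a. rho x a) ` alpha n I) = (sqd C x + (x + 1 / real n)\<^sup>2) / 2" for x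
    proof -
      have "Min ((\<lambda>a. rho x a) ` alpha n I)
          = Min ((\<lambda>z. (z + (x + 1 / real n)\<^sup>2) / 2) ` (\<lambda>u. (x - u)\<^sup>2) ` C)"
        by (simp add: alpha image_image rho_Uinv)
      also have "\<dots> = (sqd C x + (x + 1 / real n)\<^sup>2) / 2"
        unfolding sqd_def using C
        by (intro mono_Min_commute[symmetric]) (auto simp: mono_def)
      finally show ?thesis .
    qed
    then have "Verr P (alpha n I) = L (\<lambda>x. (sqd C x + (x + 1 / real n)\<^sup>2) / 2)"
      by (simp only: Verr_def L_def)
    then show ?thesis
      using Verr_mixed[OF C(1,2)] LC by simp
  qed

  have Verr_lower: "(G + Q) / 2 \<le> Verr P \<alpha>" if \<alpha>: "\<alpha> \<in> constr_admissible n" for \<alpha>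
  proof -
    define \<beta> where "\<beta> = (\<lambda>pq. fst pq + snd pq) ` \<alpha>"
    have fin: "finite \<alpha>" "\<alpha> \<noteq> {}" and card: "card \<alpha> \<le> n"
      using \<alpha> by (auto simp: constr_admissible_def)
    have \<beta>: "finite \<beta>" "\<beta> \<noteq> {}" "card \<beta> \<le> n"
      unfolding \<beta>_def using fin card card_image_le[OF fin(1), of "\<lambda>pq. fst pq + snd pq"] by auto
    \<comment> \<open>On \<open>S j\<close> the difference is \<open>1 / j\<close>, and
      \<open>j \<le> n\<close>.\<close>
    have slack: "1 / real n \<le> snd pq - fst pq" if pq: "pq \<in> \<alpha>" for pq
    proof -
      obtain j where "j \<in> {1..n}" "pq \<in> S j"
        using pq \<alpha> unfolding constr_admissible_def by blast
      then show ?thesis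
        by (auto simp: S_def intro!: divide_left_mono)
    qed
    have "(G + Q) / 2 \<le> L (\<lambda>x. (sqd \<beta> x + (x + 1 / real n)\<^sup>2) / 2)"
      using lower[OF \<beta>] Verr_mixed[OF \<beta>(1,2)] by simp
    also have "\<dots> \<le> L (\<lambda>x. Min ((\<lambda>a. rho x a) ` \<alpha>))"
    proof (rule mono)
      show "continuous_on UNIV (\<lambda>x. (sqd \<beta> x + (x + 1 / real n)\<^sup>2) / 2)"
        using \<beta> by (auto intro!: continuous_intros)
      show "continuous_on UNIV (\<lambda>x. Min ((\<lambda>a. rho x a) ` \<alpha>))"
        using fin
      proof (induction rule: finite_ne_induct)
        case (insert a F)
        then have "Min (rho x ` insert a F) = min (rho x a) (Min (rho x ` F))" for x
          by simp
        then show ?case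
          using insert by (auto simp: rho_def intro!: continuous_intros)
      qed (auto simp: rho_def intro!: continuous_intros)
      fix x :: real
      assume x: "0 \<le> x" "x \<le> 1"
      have "(sqd \<beta> x + (x + 1 / real n)\<^sup>2) / 2 \<le> rho x pq" if "pq \<in> \<alpha>" for pq
      proof -
        have "sqd \<beta> x \<le> (x - (fst pq + snd pq))\<^sup>2"
          using \<beta>(1) that by (intro sqd_le) (auto simp: \<beta>_def)
        \<comment> \<open>Squaring preserves the order since \<open>x \<ge> 0\<close>; this is where
          the support in \<open>[0, 1]\<close> enters.\<close>
        moreover have "(x + 1 / real n)\<^sup>2 \<le> (x + (snd pq - fst pq))\<^sup>2"
          using slack[OF that] x by (intro power_mono) auto
        ultimately show ?thesis
          by (simp add: rho_eq)
      qed
      then show "(sqd \<beta> x + (x + 1 / real n)\<^sup>2) / 2 \<le> Min ((\<lambda>a. rho x a) ` \<alpha>)"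
        using fin by (intro Min.boundedI) auto
    qed
    finally show ?thesis
      by (simp add: Verr_def L_def)
  qed

  have admissible: "alpha n I \<in> constr_admissible n"
  proof -
    have "0 \<le> aw \<sigma> \<and> aw \<sigma> \<le> 1" for \<sigma>
      unfolding aw_def by (rule Tw_unit_interval) auto
    then have "alpha n I \<subseteq> S n"
      by (auto simp: alpha C_def centers_def intro!: Uinv_in_S)
    also have "S n \<subseteq> (\<Union>j\<in>{1..n}. S j)"
      using n1 by (intro UN_upper) simp
    finally have "alpha n I \<subseteq> (\<Union>j\<in>{1..n}. S j)" .
    moreover have "card (alpha n I) \<le> n"
      using card_image_le[OF C(1), of "Uinv n"] C(3) by (simp add: alpha)
    moreover have "1 \<le> card (alpha n I)"
      using C by (simp add: alpha Suc_le_eq card_gt_0_iff)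
    ultimately show ?thesis
      unfolding constr_admissible_def using C(1) by (simp add: alpha)
  qed
  have Vc: "Vc P n = Verr P (alpha n I)"
    unfolding Vc_def using admissible Verr_lower[folded Verr_alpha]
    by (intro cInf_eq_minimum) auto

  \<comment> \<open>On each cell the mean of \<open>(x + 1 / n)\<^sup>2\<close> is the variance plus
    the value at the centre. The variances sum to \<open>G\<close>; at a centre
    \<open>rho_Uinv\<close> retains half of the value, hence the factor 2.\<close>
  have "Q = G + 2 * Aterm n I"
  proof -
    define h where "h \<sigma> = (aw \<sigma> + 1 / real n)\<^sup>2" for \<sigma>
    have Tw: "L (\<lambda>x. (Tw \<sigma> x + 1 / real n)\<^sup>2) = 1 / (8 * 9 ^ length \<sigma>) + h \<sigma>" for \<sigma>
      using Tw_square[of \<sigma> "- 1 / real n"] by (simp add: h_def)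
    have "continuous_on UNIV (\<lambda>x::real. (x + 1 / real n)\<^sup>2)"
      by (intro continuous_intros)
    from split_partition[OF this assms(3)]
    have "Q = G + ((\<Sum>\<sigma>\<in>words (ell n) - I. 1 / 2 ^ ell n * h \<sigma>)
      + (\<Sum>\<sigma>\<in>I. 1 / 2 ^ (ell n + 1) * (h (\<sigma> @ [1]) + h (\<sigma> @ [2]))))"
      unfolding Q_def Tw partition_variance[OF I] G_def .
    moreover have "2 * Aterm n I = ((\<Sum>\<sigma>\<in>words (ell n) - I. 1 / 2 ^ ell n * h \<sigma>)
      + (\<Sum>\<sigma>\<in>I. 1 / 2 ^ (ell n + 1) * (h (\<sigma> @ [1]) + h (\<sigma> @ [2]))))"
      unfolding Aterm_def rho_Uinv h_def distrib_left sum_distrib_left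
      by (intro arg_cong2[of _ _ _ _ "(+)"] sum.cong) auto
    ultimately show ?thesis by simp
  qed
  then have "Verr P (alpha n I) = G + Aterm n I"
    unfolding Verr_alpha by simp
  moreover have "(\<lambda>a. (U n a, 0::real)) ` alpha n I = (\<lambda>u. (u, 0)) ` C"
    by (simp add: alpha image_image U_Uinv)
  then have "G = Verr P ((\<lambda>a. (U n a, 0)) ` alpha n I)"
    using LC by (simp add: Verr_axis L_def)
  moreover have "Vu P n = G"
    unfolding Vu_def Verr_axis L_def[symmetric]
  proof (rule cInf_eq_minimum)
    show "G \<in> {L (sqd \<beta>) |\<beta>. finite \<beta> \<and> 1 \<le> card \<beta> \<and> card \<beta> \<le> n}"
      using LC C by (auto simp: Suc_le_eq card_gt_0_iff intro!: exI[of _ C])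
    show "G \<le> z" if "z \<in> {L (sqd \<beta>) |\<beta>. finite \<beta> \<and> 1 \<le> card \<beta> \<and> card \<beta> \<le> n}" for z
      using that by (auto intro!: lower)
  qed
  ultimately show ?thesis
    using Vc admissible unfolding constr_optimal_def G_def by simp
qed

end
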